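(* Let $n$ and $q$ be integers with $n>q>0$, and let $p$ be a prime with $p\equiv 1 \pmod q$. Then \[ \operatorname{ord}_p\Big[\gcd_{0<k<n/q} \binom{n}{qk}\Big] = \begin{cases} 1 & \text{if } \alpha_p(n)\le q,\\ 0 & \text{otherwise,} \end{cases} \] where the greatest common divisor is taken over all integers $k$ with $0<k<n/q$.
   Context: For a nonzero integer $m$ and a prime $p$, $\operatorname{ord}_p(m)$ denotes the exponent of the highest power of $p$ dividing $m$. For a positive integer $n$, $\alpha_p(n)$ denotes the sum of the digits of the base-$p$ expansion of $n$; equivalently, it is the smallest integer $r$ such that $n=p^{i_1}+\cdots+p^{i_r}$ for some integers $0\le i_1\le\cdots\le i_r$. *)

theory Defs
  imports Complex_Main "HOL-Number_Theory.Number_Theory"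
begin

(* Sum of the digits of n in base b (meant for b >= 2): the i-th digit is
   n div b^i mod b, and the positions i with b^i <= n are exactly those
   occupied by the expansion of n > 0. *)
definition digit_sum :: "nat \<Rightarrow> nat \<Rightarrow> nat" where
  "digit_sum b n = (\<Sum>i | b ^ i \<le> n. n div b ^ i mod b)"

end

theory Submission
  imports Defs
begin

text \<open>
  By Legendre's formula, \<open>(p - 1) ord\<^sub>p(n choose m) = \<alpha>(m) + \<alpha>(n - m) - \<alpha>(n)\<close>; in particular
  \<open>\<alpha>\<close> is subadditive. Since \<open>p \<equiv> 1 (mod q)\<close>, also \<open>\<alpha>(m) \<equiv> m (mod q)\<close>.
  If \<open>\<alpha>(n) > q\<close>, let \<open>m\<close> be the sum of \<open>q\<close> of the powers of \<open>p\<close> that make up \<open>n\<close>: then \<open>q\<close>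
  divides \<open>m\<close> and \<open>p\<close> does not divide \<open>n choose m\<close>. If \<open>\<alpha>(n) \<le> q\<close>, a multiple \<open>m\<close> of \<open>q\<close> with
  \<open>0 < m < n\<close> has \<open>\<alpha>(m) \<ge> q\<close>, so \<open>\<alpha>(m) + \<alpha>(n - m) > \<alpha>(n)\<close> and \<open>p\<close> divides \<open>n choose m\<close>.
  Replacing some \<open>p^(i+1)\<close> in the expansion of \<open>n\<close> by \<open>p\<close> copies of \<open>p^i\<close> and taking
  \<open>m = q p^i\<close> gives a binomial coefficient not divisible by \<open>p\<^sup>2\<close>.
\<close>

section \<open>Digit sums in an arbitrary base: recursion, congruence, removal of a power\<close>

lemma digit_sum_0 [simp]: "b \<ge> 2 \<Longrightarrow> digit_sum b 0 = 0"
  by (simp add: digit_sum_def)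

text \<open>The occupied positions of \<open>n > 0\<close> are 0 and the successors of those of
  \<open>n div b\<close>; reindexing the sum along \<open>Suc\<close> splits off the last
  digit.\<close>

lemma digit_sum_rec:
  assumes b: "b \<ge> 2"
  shows "digit_sum b n = n mod b + digit_sum b (n div b)"
proof (cases "n = 0")
  case True
  then show ?thesis using b by simp
next
  case False
  have le_iff: "b ^ Suc i \<le> n \<longleftrightarrow> b ^ i \<le> n div b" for i
    using b by (simp add: less_eq_div_iff_mult_less_eq mult.commute)
  have set_eq: "{i. b ^ i \<le> n} = insert 0 (Suc ` {i. b ^ i \<le> n div b})"
  proof (rule Set.set_eqI)
    fix j
    show "j \<in> {i. b ^ i \<le> n} \<longleftrightarrow> j \<in> insert 0 (Suc ` {i. b ^ i \<le> n div b})"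
      using False le_iff by (cases j) (auto simp del: power_Suc)
  qed
  have fin: "finite {i. b ^ i \<le> m}" for m
  proof (rule finite_subset)
    show "{i. b ^ i \<le> m} \<subseteq> {..m}"
    proof (clarsimp)
      fix i assume "b ^ i \<le> m"
      moreover have "i < b ^ i" using b by (intro power_gt_expt) simp
      ultimately show "i \<le> m" by linarith
    qed
  qed simp
  show ?thesis
    unfolding digit_sum_def set_eq using fin
    by (simp add: sum.reindex div_mult2_eq)
qed

lemma digit_sum_pos:
  assumes b: "b \<ge> 2" and "n > 0"
  shows "digit_sum b n > 0"
  using \<open>n > 0\<close>
proof (induction n rule: less_induct)
  case (less n)
  show ?case
  proof (cases "n mod b = 0")
    case True
    then have "n div b > 0" "n div b < n" using less.prems b
      by (auto simp: div_greater_zero_iff dvd_imp_le mod_eq_0_iff_dvd)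
    then show ?thesis using less.IH digit_sum_rec[OF b, of n] by fastforce
  qed (simp add: digit_sum_rec[OF b, of n])
qed

lemma digit_sum_cong:
  assumes b: "b \<ge> 2" and bq: "[b = 1] (mod q)"
  shows "[digit_sum b n = n] (mod q)"
proof (induction n rule: less_induct)
  case (less n)
  show ?case
  proof (cases "n = 0")
    case False
    then have "[digit_sum b (n div b) = n div b] (mod q)" using less b by simp
    \<comment> \<open>The explicit factor 1 is what \<open>bq\<close> exchanges for
      \<open>b\<close>.\<close>
    then have "[n mod b + 1 * digit_sum b (n div b) = n mod b + b * (n div b)] (mod q)"
      by (intro cong_add cong_mult cong_refl cong_sym[OF bq])
    then show ?thesis by (simp add: digit_sum_rec[OF b, of n])
  qed (use b in simp)
qed

lemma digit_sum_power:
  assumes b: "b \<ge> 2"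
  shows "digit_sum b (b ^ i) = 1"
proof (induction i)
  case 0
  show ?case using b by (subst digit_sum_rec) auto
next
  case (Suc i)
  then show ?case using b by (subst digit_sum_rec) auto
qed

text \<open>Lower the last nonzero digit by one, so that no borrow occurs: the induction strips
  trailing zeros until \<open>i = 0\<close> works.\<close>

lemma digit_sum_peel:
  assumes b: "b \<ge> 2" and "n > 0"
  shows "\<exists>i. b ^ i \<le> n \<and> Suc (digit_sum b (n - b ^ i)) = digit_sum b n"
  using \<open>n > 0\<close>
proof (induction n rule: less_induct)
  case (less n)
  have rec: "digit_sum b n = n mod b + digit_sum b (n div b)"
    by (rule digit_sum_rec[OF b])
  show ?case
  proof (cases "n mod b = 0")
    case True
    then have "n div b > 0" "n div b < n" using less.prems b
      by (auto simp: div_greater_zero_iff dvd_imp_le mod_eq_0_iff_dvd)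
    with less.IH obtain i where i: "b ^ i \<le> n div b"
      "Suc (digit_sum b (n div b - b ^ i)) = digit_sum b (n div b)" by blast
    have n: "n = b * (n div b)" using True by auto
    have "n - b ^ Suc i = b * (n div b - b ^ i)"
      by (subst n) (simp add: diff_mult_distrib2)
    then have "digit_sum b (n - b ^ Suc i) = digit_sum b (n div b - b ^ i)"
      using b digit_sum_rec[OF b, of "n - b ^ Suc i"] by simp
    moreover have "b ^ Suc i \<le> n" using i(1) by (subst n) simp
    ultimately show ?thesis using i(2) rec True by (metis add_0)
  next
    case False
    then obtain r where r: "n mod b = Suc r" by (cases "n mod b") auto
    moreover have "r < b" using r b by (metis Suc_lessD mod_less_divisor not_numeral_le_zero not_gr0)
    ultimately have "n - 1 = r + b * (n div b)" "r < b"
      using mod_mult_div_eq[of n b] by linarith+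
    then have "digit_sum b (n - 1) = r + digit_sum b (n div b)"
      using b digit_sum_rec[OF b, of "n - 1"] by simp
    then show ?thesis using rec r less.prems by (intro exI[of _ 0]) auto
  qed
qed

text \<open>A positive exponent is required later so that the removed power can be broken into
  \<open>b\<close> copies of the next lower one. Peeling \<open>n div b\<close> leaves the last
  digit of \<open>n\<close> untouched and raises the exponent by one.\<close>

lemma digit_sum_peel_Suc:
  assumes b: "b \<ge> 2" and n: "n \<ge> b"
  shows "\<exists>i. b ^ Suc i \<le> n \<and> Suc (digit_sum b (n - b ^ Suc i)) = digit_sum b n"
proof -
  have "n div b > 0" using b n by (simp add: div_greater_zero_iff)
  with digit_sum_peel[OF b] obtain i where i: "b ^ i \<le> n div b"
    "Suc (digit_sum b (n div b - b ^ i)) = digit_sum b (n div b)" by blast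
  have le: "b ^ Suc i \<le> b * (n div b)" using i(1) by simp
  have "n - b ^ Suc i = b * (n div b) - b ^ Suc i + n mod b"
    using le mult_div_mod_eq[of b n] by linarith
  also have "\<dots> = n mod b + b * (n div b - b ^ i)"
    by (simp add: diff_mult_distrib2)
  finally have "digit_sum b (n - b ^ Suc i) = n mod b + digit_sum b (n div b - b ^ i)"
    using b digit_sum_rec[OF b, of "n - b ^ Suc i"] by simp
  moreover have "b ^ Suc i \<le> n" using le mult_div_mod_eq[of b n] by linarith
  ultimately show ?thesis using i(2) digit_sum_rec[OF b, of n] by (metis add_Suc_right)
qed

section \<open>Legendre's formula and the multiplicity of a binomial coefficient\<close>

lemma digit_sum_Suc:
  assumes p: "prime p"
  shows "(p - 1) * multiplicity p (Suc n) + digit_sum p (Suc n) = Suc (digit_sum p n)"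
proof (induction n rule: less_induct)
  case (less n)
  have p2: "p \<ge> 2" using p by (rule prime_ge_2_nat)
  note rec = digit_sum_rec[OF p2]
  show ?case
  proof (cases "p dvd Suc n")
    case False
    then have "Suc (n mod p) \<noteq> p"
      using mod_Suc[of n p] by (auto simp: dvd_eq_mod_eq_0)
    then have "Suc n mod p = Suc (n mod p)" "Suc n div p = n div p"
      by (simp_all add: mod_Suc div_Suc dvd_eq_mod_eq_0)
    then show ?thesis using False rec[of n] rec[of "Suc n"]
      by (simp add: not_dvd_imp_multiplicity_0)
  next
    case True
    then obtain k where k: "Suc n = p * k" by (rule dvdE)
    then have "k \<noteq> 0" by (cases "k = 0") auto
    then obtain j where j: "k = Suc j" by (cases k) auto
    \<comment> \<open>The last digit of \<open>n\<close> is \<open>p - 1\<close>, so adding 1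
      carries into \<open>j\<close>. The carry costs \<open>p - 1\<close> in the digit sum, which is
      balanced by one factor \<open>p\<close> of \<open>Suc n\<close>.\<close>
    have n: "n = (p - 1) + p * j" using k j p2 by simp
    have "j \<le> p * j" using p2 by simp
    then have "j < n" using n p2 by linarith
    then have IH: "(p - 1) * multiplicity p k + digit_sum p k = Suc (digit_sum p j)"
      using less.IH j by blast
    have "n mod p = p - 1" unfolding n using p2 by (subst mod_mult_self2) simp
    moreover have "n div p = j" unfolding n using p2 by (subst div_mult_self2) simp_all
    ultimately have "digit_sum p n = (p - 1) + digit_sum p j"
      using rec[of n] by simp
    moreover have "digit_sum p (Suc n) = digit_sum p k"
      using k p2 rec[of "Suc n"] by simp
    moreover have "multiplicity p (Suc n) = Suc (multiplicity p k)"
      unfolding k using p \<open>k \<noteq> 0\<close> by (intro multiplicity_times_same) auto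
    ultimately show ?thesis using IH by simp
  qed
qed

text \<open>The identity for \<open>Suc n\<close> telescopes over the factors of the factorial.
  Keeping the digit sum on the left avoids division and a truncated difference.\<close>

lemma legendre_digit_sum:
  assumes p: "prime p"
  shows "(p - 1) * multiplicity p (fact n :: nat) + digit_sum p n = n"
proof (induction n)
  case 0
  show ?case using prime_ge_2_nat[OF p] by simp
next
  case (Suc n)
  have "multiplicity p (fact (Suc n) :: nat) = multiplicity p (Suc n) + multiplicity p (fact n :: nat)"
    unfolding fact_Suc using p by (subst prime_elem_multiplicity_mult_distrib) auto
  then show ?case using Suc digit_sum_Suc[OF p, of n] by (simp add: distrib_left)
qed

text \<open>Legendre's formula for the three factorials; the terms \<open>n\<close>,
  \<open>m\<close> and \<open>n - m\<close> cancel.\<close>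

lemma multiplicity_binomial_digit_sum:
  assumes p: "prime p" and "m \<le> n"
  shows "(p - 1) * multiplicity p (n choose m) + digit_sum p n = digit_sum p m + digit_sum p (n - m)"
proof -
  have "fact n = (fact m * fact (n - m) * (n choose m) :: nat)"
    using binomial_fact_lemma[OF \<open>m \<le> n\<close>] by simp
  then have "multiplicity p (fact n :: nat) = multiplicity p (fact m :: nat)
      + multiplicity p (fact (n - m) :: nat) + multiplicity p (n choose m)"
    using p \<open>m \<le> n\<close> by (simp add: prime_elem_multiplicity_mult_distrib)
  then have "(p - 1) * multiplicity p (fact n :: nat) = (p - 1) * multiplicity p (fact m :: nat)
      + (p - 1) * multiplicity p (fact (n - m) :: nat) + (p - 1) * multiplicity p (n choose m)"
    by (simp add: distrib_left)
  then show ?thesis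
    using legendre_digit_sum[OF p, of n] legendre_digit_sum[OF p, of m]
      legendre_digit_sum[OF p, of "n - m"] \<open>m \<le> n\<close> by linarith
qed

section \<open>Subadditivity and splitting of digit sums\<close>

lemma digit_sum_add_le:
  assumes p: "prime p"
  shows "digit_sum p (a + b) \<le> digit_sum p a + digit_sum p b"
  using multiplicity_binomial_digit_sum[OF p, of a "a + b"] by simp

lemma digit_sum_mult_power_le:
  assumes p: "prime p"
  shows "digit_sum p (c * p ^ i) \<le> c"
proof (induction c)
  case 0
  show ?case using prime_ge_2_nat[OF p] by simp
next
  case (Suc c)
  then show ?case
    using digit_sum_add_le[OF p, of "p ^ i" "c * p ^ i"]
      digit_sum_power[OF prime_ge_2_nat[OF p], of i] by simp
qed

lemma digit_sum_split:
  assumes p: "prime p" and "c \<le> digit_sum p n"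
  shows "\<exists>m\<le>n. digit_sum p m = c \<and> digit_sum p (n - m) + c = digit_sum p n"
proof -
  have p2: "p \<ge> 2" using p by (rule prime_ge_2_nat)
  \<comment> \<open>Moving one power at a time from \<open>n - m\<close> to \<open>m\<close>, the
    induction carries only an upper bound for the digit sum of \<open>m\<close>. Subadditivity for
    \<open>m + (n - m)\<close> gives the reverse bound at the end.\<close>
  have "\<exists>m\<le>n. digit_sum p m \<le> c \<and> digit_sum p (n - m) + c = digit_sum p n"
    using \<open>c \<le> digit_sum p n\<close>
  proof (induction c)
    case 0
    show ?case using p2 by (intro exI[of _ 0]) simp
  next
    case (Suc c)
    then obtain m where m: "m \<le> n" "digit_sum p m \<le> c"
      "digit_sum p (n - m) + c = digit_sum p n" by auto
    have "n - m > 0" using m Suc.prems p2 by (cases "n - m = 0") auto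
    with digit_sum_peel[OF p2] obtain i where i: "p ^ i \<le> n - m"
      "Suc (digit_sum p (n - m - p ^ i)) = digit_sum p (n - m)" by blast
    show ?case
    proof (intro exI conjI)
      show "m + p ^ i \<le> n" using i m by linarith
      show "digit_sum p (m + p ^ i) \<le> Suc c"
        using digit_sum_add_le[OF p, of m "p ^ i"] digit_sum_power[OF p2, of i] m by linarith
      show "digit_sum p (n - (m + p ^ i)) + Suc c = digit_sum p n" using i m by simp
    qed
  qed
  then obtain m where m: "m \<le> n" "digit_sum p m \<le> c"
    "digit_sum p (n - m) + c = digit_sum p n" by blast
  moreover have "digit_sum p n \<le> digit_sum p m + digit_sum p (n - m)"
    using digit_sum_add_le[OF p, of m "n - m"] m by simp
  ultimately show ?thesis by (intro exI[of _ m]) auto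
qed

section \<open>The gcd of the binomial coefficients\<close>

theorem theoremQ:
  fixes n q p :: nat
  assumes "n > q" and "q > 0" and "prime p" and "[p = 1] (mod q)"
  shows "multiplicity p (Gcd {n choose (q * k) | k :: nat. 0 < k \<and> real k < real n / real q})
    = (if digit_sum p n \<le> q then 1 else 0)"
proof -
  note p = \<open>prime p\<close>
  have p2: "p \<ge> 2" using p by (rule prime_ge_2_nat)
  have "q dvd p - 1" using assms(4) p2 by (simp add: cong_altdef_nat)
  then have qp: "q \<le> p - 1" using p2 by (intro dvd_imp_le) auto
  define S where "S = {n choose (q * k) | k :: nat. 0 < k \<and> real k < real n / real q}"
  have S_eq: "S = {n choose m | m. q dvd m \<and> 0 < m \<and> m < n}"
  proof -
    have "real k < real n / real q \<longleftrightarrow> q * k < n" for k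
    proof -
      have "real k < real n / real q \<longleftrightarrow> real (q * k) < real n"
        using \<open>q > 0\<close> by (simp add: field_simps)
      then show ?thesis by (simp only: of_nat_less_iff)
    qed
    then show ?thesis unfolding S_def using \<open>q > 0\<close> by (auto simp: dvd_def)
  qed
  have mult_le: "multiplicity p (Gcd S) \<le> multiplicity p (n choose m)"
    if "q dvd m" "0 < m" "m < n" for m
  proof (rule dvd_imp_multiplicity_le)
    show "Gcd S dvd n choose m" unfolding S_eq using that by (intro Gcd_dvd) auto
  qed (use that in auto)
  show ?thesis
  proof (cases "digit_sum p n \<le> q")
    case True
    have "p dvd n choose m" if m: "q dvd m" "0 < m" "m < n" for m
    proof -
      have "q dvd digit_sum p m"
        using cong_dvd_iff[OF digit_sum_cong[OF p2 assms(4), of m]] m(1) by simp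
      then have "q \<le> digit_sum p m" using digit_sum_pos[OF p2 m(2)] by (rule dvd_imp_le)
      moreover have "digit_sum p (n - m) > 0" using m(3) by (intro digit_sum_pos[OF p2]) simp
      ultimately have "(p - 1) * multiplicity p (n choose m) > 0"
        using multiplicity_binomial_digit_sum[OF p, of m n] m(3) True by linarith
      then show ?thesis using not_dvd_imp_multiplicity_0 by fastforce
    qed
    then have "p dvd Gcd S" unfolding S_eq by (intro Gcd_greatest) auto
    \<comment> \<open>Since \<open>multiplicity p 0\<close> is 0 by convention, divisibility by
      \<open>p\<close> bounds the multiplicity from below only for a nonzero gcd;
      \<open>k = 1\<close> provides a nonzero member.\<close>
    moreover have "Gcd S \<noteq> 0"
    proof -
      have "n choose q \<in> S" unfolding S_eq using assms(1,2) by auto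
      moreover have "n choose q \<noteq> 0" using assms(1) by simp
      ultimately show ?thesis by (auto simp: Gcd_0_iff)
    qed
    ultimately have ge: "multiplicity p (Gcd S) \<ge> 1"
      using p by (intro multiplicity_geI) auto
    \<comment> \<open>This ensures that a power of \<open>p\<close> with positive exponent can be
      removed: below \<open>p\<close> the digit sum is \<open>n\<close> itself, which exceeds
      \<open>q\<close>.\<close>
    have "n \<ge> p"
    proof (rule ccontr)
      assume "\<not> n \<ge> p"
      then have "digit_sum p n = n" using p2 digit_sum_rec[OF p2, of n] by simp
      with True assms(1) show False by simp
    qed
    with digit_sum_peel_Suc[OF p2] obtain i where i: "p ^ Suc i \<le> n"
      "Suc (digit_sum p (n - p ^ Suc i)) = digit_sum p n" by blast
    let ?m = "q * p ^ i"
    have "q < p" using qp p2 by linarith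
    then have "?m < p ^ Suc i" using p2 by simp
    then have mn: "?m < n" using i(1) by linarith
    \<comment> \<open>The removed \<open>p ^ Suc i\<close> is \<open>p\<close> copies of
      \<open>p ^ i\<close>: \<open>q\<close> of them form \<open>?m\<close>, and the other
      \<open>p - q\<close> go back to the rest.\<close>
    have "n - ?m = (n - p ^ Suc i) + (p - q) * p ^ i"
      using i(1) \<open>?m < p ^ Suc i\<close> by (simp add: diff_mult_distrib)
    then have "digit_sum p (n - ?m) \<le> digit_sum p (n - p ^ Suc i) + (p - q)"
      using digit_sum_add_le[OF p, of "n - p ^ Suc i" "(p - q) * p ^ i"]
        digit_sum_mult_power_le[OF p, of "p - q" i] by simp
    \<comment> \<open>With \<alpha> for the digit sum, the left side is at most q + (\<alpha>(n) -
      1) + (p - q) - \<alpha>(n) = p - 1.\<close>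
    then have "(p - 1) * multiplicity p (n choose ?m) \<le> (p - 1) * 1"
      using multiplicity_binomial_digit_sum[OF p, of ?m n] mn i(2) \<open>q < p\<close>
        digit_sum_mult_power_le[OF p, of q i] by linarith
    then have "multiplicity p (n choose ?m) \<le> 1" using p2 by simp
    moreover have "multiplicity p (Gcd S) \<le> multiplicity p (n choose ?m)"
      using mn assms(2) p2 by (intro mult_le) auto
    ultimately show ?thesis using ge True unfolding S_def by simp
  next
    case False
    then obtain m where m: "m \<le> n" "digit_sum p m = q"
      "digit_sum p (n - m) + q = digit_sum p n"
      using digit_sum_split[OF p, of q n] by auto
    \<comment> \<open>The digit sum \<open>q\<close> of \<open>m\<close> is congruent to
      \<open>m\<close> modulo \<open>q\<close>.\<close>
    have "q dvd m"
      using cong_dvd_iff[OF digit_sum_cong[OF p2 assms(4), of m]] m(2) by simp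
    moreover have "0 < m" using m(2) assms(2) p2 by (cases "m = 0") auto
    moreover have "m < n" using m(1,3) False p2 by (cases "m = n") auto
    moreover have "(p - 1) * multiplicity p (n choose m) = 0"
      using multiplicity_binomial_digit_sum[OF p m(1)] m(2,3) by linarith
    then have "multiplicity p (n choose m) = 0" using p2 by simp
    ultimately show ?thesis using mult_le[of m] False unfolding S_def by simp
  qed
qed

end
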